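(* Let $F$ be a field and let $A$ be a non-empty finite subset of $\mathbb N$. Then the element $$e_A=\sum_{P\in\Pi_A^*}(-1)^{\ell(P)-1}P\ \in F\Pi_A$$ is $\Delta$-primitive, that is, $\Delta(e_A)=e_A\otimes\emptyset+\emptyset\otimes e_A$. In particular, $e_A$ is a primitive idempotent in the algebra $(F\Pi_A,\wedge)$.
   Context: For a finite subset $A$ of $\mathbb N=\{1,2,\ldots\}$, a set composition of $A$ is a tuple $P=(P_1,\ldots,P_l)$ of mutually disjoint non-empty subsets of $A$ with union $A$; its length is $\ell(P)=l$; $\Pi_A$ is the set of all set compositions of $A$. $\Pi_\emptyset$ consists of the empty tuple, denoted $\emptyset$. $F\Pi_A$ is the $F$-vector space with basis $\Pi_A$, an associative algebra with identity $(A)$ under the bilinear product $(P_1,\ldots,P_l)\wedge(Q_1,\ldots,Q_k)=(P_1\cap Q_1,\ldots,P_1\cap Q_k,\ldots,P_l\cap Q_1,\ldots,P_l\cap Q_k)$ with empty sets deleted. $F\Pi=\bigoplus_A F\Pi_A$ over all finite $A\subset\mathbb N$. The coproduct $\Delta:F\Pi\to F\Pi\otimes F\Pi$ is the linear map with $\Delta(P)=\sum_{X\subseteq A}P|_X\otimes P|_{A\setminus X}$ for $P=(P_1,\ldots,P_l)\in\Pi_A$, where $P|_X\in\Pi_X$ is $(P_1\cap X,\ldots,P_l\cap X)$ with empty sets deleted. $\Pi_A^*=\{(P_1,\ldots,P_l)\in\Pi_A\mid\min A\in P_1\}$. An idempotent is an element $e\ne0$ of $F\Pi_A$ with $e\wedge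 e=e$; it is primitive if the left ideal $F\Pi_A\wedge e$ is an indecomposable $F\Pi_A$-module. *)

theory Defs
  imports "HOL-Library.Poly_Mapping" "HOL-Library.Disjoint_Sets" "HOL-Algebra.Ideal"
begin

section \<open>Set compositions\<close>

text \<open>
  A set composition is a list of sets. For a list of non-empty sets, mutual disjointness of the
  entries means that the list is distinct and that its set of entries is disjoint.
\<close>

definition setcomps :: "nat set \<Rightarrow> nat set list set" where
  "setcomps A = {P. distinct P \<and> partition_on A (set P)}"

definition setcomps_min :: "nat set \<Rightarrow> nat set list set" where
  "setcomps_min A = {P \<in> setcomps A. Min A \<in> hd P}"

definition delete_empty :: "nat set list \<Rightarrow> nat set list" where
  "delete_empty P = filter (\<lambda>X. X \<noteq> {}) P"

definition setcomp_meet :: "nat set list \<Rightarrow> nat set list \<Rightarrow> nat set list" where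
  "setcomp_meet P Q = delete_empty [X \<inter> Y. X \<leftarrow> P, Y \<leftarrow> Q]"

definition setcomp_restrict :: "nat set list \<Rightarrow> nat set \<Rightarrow> nat set list" where
  "setcomp_restrict P X = delete_empty (map (\<lambda>Y. Y \<inter> X) P)"

section \<open>The vector spaces and their operations\<close>

text \<open>
  The free vector space on a set of type \<open>'b\<close> is represented by finitely supported functions
  \<open>'b \<Rightarrow>\<^sub>0 'f\<close>; the basis vector of \<open>b\<close> is \<open>Poly_Mapping.single b 1\<close>. The tensor product of the
  free spaces on two sets is represented as the free space on their Cartesian product,
  with \<open>b \<otimes> c\<close> being the basis vector of the pair \<open>(b, c)\<close>.
\<close>

definition setcomp_space :: "nat set \<Rightarrow> (nat set list \<Rightarrow>\<^sub>0 'f::field) set" where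
  "setcomp_space A = {x. Poly_Mapping.keys x \<subseteq> setcomps A}"

text \<open>Bilinear extension of a map on pairs of basis vectors:\<close>

definition bilinear_ext ::
    "('a \<Rightarrow> 'b \<Rightarrow> 'c) \<Rightarrow> ('a \<Rightarrow>\<^sub>0 'f::field) \<Rightarrow> ('b \<Rightarrow>\<^sub>0 'f) \<Rightarrow> ('c \<Rightarrow>\<^sub>0 'f)" where
  "bilinear_ext f x y = (\<Sum>P\<in>Poly_Mapping.keys x. \<Sum>Q\<in>Poly_Mapping.keys y.
     Poly_Mapping.single (f P Q) (Poly_Mapping.lookup x P * Poly_Mapping.lookup y Q))"

definition wedge ::
    "(nat set list \<Rightarrow>\<^sub>0 'f::field) \<Rightarrow> (nat set list \<Rightarrow>\<^sub>0 'f) \<Rightarrow> (nat set list \<Rightarrow>\<^sub>0 'f)" where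
  "wedge = bilinear_ext setcomp_meet"

definition tensor ::
    "('a \<Rightarrow>\<^sub>0 'f::field) \<Rightarrow> ('b \<Rightarrow>\<^sub>0 'f) \<Rightarrow> ('a \<times> 'b \<Rightarrow>\<^sub>0 'f)" where
  "tensor = bilinear_ext Pair"

text \<open>A basis vector \<open>P\<close> belongs to the space of the set \<open>\<Union>(set P)\<close>.\<close>

definition coproduct ::
    "(nat set list \<Rightarrow>\<^sub>0 'f::field) \<Rightarrow> (nat set list \<times> nat set list \<Rightarrow>\<^sub>0 'f)" where
  "coproduct x = (\<Sum>P\<in>Poly_Mapping.keys x. \<Sum>X\<in>Pow (\<Union>(set P)).
     Poly_Mapping.single (setcomp_restrict P X, setcomp_restrict P (\<Union>(set P) - X))
       (Poly_Mapping.lookup x P))"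

definition empty_comp :: "nat set list \<Rightarrow>\<^sub>0 'f::field" where
  "empty_comp = Poly_Mapping.single [] 1"

definition e_elem :: "nat set \<Rightarrow> (nat set list \<Rightarrow>\<^sub>0 'f::field)" where
  "e_elem A = (\<Sum>P\<in>setcomps_min A. Poly_Mapping.single P ((- 1) ^ (length P - 1)))"

text \<open>In the identity, \<open>delete_empty\<close> only matters for \<open>A = {}\<close>, where it yields the empty tuple.\<close>

definition setcomp_algebra :: "nat set \<Rightarrow> (nat set list \<Rightarrow>\<^sub>0 'f::field) ring" where
  "setcomp_algebra A = \<lparr>carrier = setcomp_space A, mult = wedge,
     one = Poly_Mapping.single (delete_empty [A]) 1, zero = 0, add = (+)\<rparr>"

section \<open>Primitive idempotents of a ring\<close>

text \<open>
  The submodules of a left ideal are the left ideals contained in it. In an algebra with identity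
  over a field, left ideals are automatically closed under scalar multiplication, so that for
  modules over such an algebra no separate condition on scalars is needed.
\<close>

definition left_ideal :: "'a set \<Rightarrow> ('a, 'm) ring_scheme \<Rightarrow> bool" where
  "left_ideal I R \<longleftrightarrow> additive_subgroup I R \<and>
     (\<forall>r\<in>carrier R. \<forall>x\<in>I. r \<otimes>\<^bsub>R\<^esub> x \<in> I)"

definition indecomposable_left_ideal :: "'a set \<Rightarrow> ('a, 'm) ring_scheme \<Rightarrow> bool" where
  "indecomposable_left_ideal M R \<longleftrightarrow> left_ideal M R \<and> M \<noteq> {\<zero>\<^bsub>R\<^esub>} \<and>
     (\<forall>N N'. left_ideal N R \<and> left_ideal N' R \<and> M = N <+>\<^bsub>R\<^esub> N' \<and> N \<inter> N' = {\<zero>\<^bsub>R\<^esub>} \<longrightarrow>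
        N = {\<zero>\<^bsub>R\<^esub>} \<or> N' = {\<zero>\<^bsub>R\<^esub>})"

definition idempotent_elem :: "'a \<Rightarrow> ('a, 'm) ring_scheme \<Rightarrow> bool" where
  "idempotent_elem e R \<longleftrightarrow> e \<in> carrier R \<and> e \<noteq> \<zero>\<^bsub>R\<^esub> \<and> e \<otimes>\<^bsub>R\<^esub> e = e"

definition primitive_idempotent :: "'a \<Rightarrow> ('a, 'm) ring_scheme \<Rightarrow> bool" where
  "primitive_idempotent e R \<longleftrightarrow> idempotent_elem e R \<and>
     indecomposable_left_ideal {r \<otimes>\<^bsub>R\<^esub> e | r. r \<in> carrier R} R"

section \<open>Well-definedness\<close>

lemma finite_setcomps:
  assumes "finite A"
  shows "finite (setcomps A)"
proof (rule finite_subset)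
  show "setcomps A \<subseteq> {P. set P \<subseteq> Pow A \<and> distinct P}"
    by (auto simp: setcomps_def partition_on_def)
  show "finite {P. set P \<subseteq> Pow A \<and> distinct P}"
    using finite_subset_distinct[of "Pow A"] assms by simp
qed

lemma keys_sum_subset:
  "Poly_Mapping.keys (sum g I) \<subseteq> (\<Union>i\<in>I. Poly_Mapping.keys (g i))"
proof (induction I rule: infinite_finite_induct)
  case (insert i I)
  then show ?case using keys_add[of "g i" "sum g I"] by auto
qed auto

lemma e_elem_in_space: "(e_elem A :: nat set list \<Rightarrow>\<^sub>0 'f::field) \<in> setcomp_space A"
proof -
  have "Poly_Mapping.keys (e_elem A :: nat set list \<Rightarrow>\<^sub>0 'f) \<subseteq>
      (\<Union>P\<in>setcomps_min A. Poly_Mapping.keys (Poly_Mapping.single P ((- 1) ^ (length P - 1) :: 'f)))"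
    unfolding e_elem_def by (rule keys_sum_subset)
  then show ?thesis
    by (auto simp: setcomp_space_def setcomps_min_def split: if_splits)
qed

lemma bilinear_ext_superset:
  assumes "finite S" "Poly_Mapping.keys x \<subseteq> S" "finite T" "Poly_Mapping.keys y \<subseteq> T"
  shows "bilinear_ext f x y = (\<Sum>P\<in>S. \<Sum>Q\<in>T.
    Poly_Mapping.single (f P Q) (Poly_Mapping.lookup x P * Poly_Mapping.lookup y Q))"
proof -
  have "bilinear_ext f x y = (\<Sum>P\<in>Poly_Mapping.keys x. \<Sum>Q\<in>T.
      Poly_Mapping.single (f P Q) (Poly_Mapping.lookup x P * Poly_Mapping.lookup y Q))"
    unfolding bilinear_ext_def
    by (intro sum.cong refl sum.mono_neutral_left assms) (auto simp: in_keys_iff)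
  also have "\<dots> = (\<Sum>P\<in>S. \<Sum>Q\<in>T.
      Poly_Mapping.single (f P Q) (Poly_Mapping.lookup x P * Poly_Mapping.lookup y Q))"
    by (intro sum.mono_neutral_left assms) (auto simp: in_keys_iff)
  finally show ?thesis .
qed

lemma bilinear_ext_add_left: "bilinear_ext f (x + y) z = bilinear_ext f x z + bilinear_ext f y z"
proof -
  let ?S = "Poly_Mapping.keys x \<union> Poly_Mapping.keys y"
  have "bilinear_ext f w z = (\<Sum>P\<in>?S. \<Sum>Q\<in>Poly_Mapping.keys z.
      Poly_Mapping.single (f P Q) (Poly_Mapping.lookup w P * Poly_Mapping.lookup z Q))"
    if "Poly_Mapping.keys w \<subseteq> ?S" for w
    by (rule bilinear_ext_superset) (use that in auto)
  with keys_add[of x y] show ?thesis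
    by (simp add: lookup_add distrib_right single_add sum.distrib)
qed

lemma bilinear_ext_add_right: "bilinear_ext f z (x + y) = bilinear_ext f z x + bilinear_ext f z y"
proof -
  let ?S = "Poly_Mapping.keys x \<union> Poly_Mapping.keys y"
  have "bilinear_ext f z w = (\<Sum>P\<in>Poly_Mapping.keys z. \<Sum>Q\<in>?S.
      Poly_Mapping.single (f P Q) (Poly_Mapping.lookup z P * Poly_Mapping.lookup w Q))"
    if "Poly_Mapping.keys w \<subseteq> ?S" for w
    by (rule bilinear_ext_superset) (use that in auto)
  with keys_add[of x y] show ?thesis
    by (simp add: lookup_add distrib_left single_add sum.distrib)
qed

lemma bilinear_ext_zero [simp]: "bilinear_ext f 0 y = 0" "bilinear_ext f x 0 = 0"
  by (simp_all add: bilinear_ext_def)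

lemma bilinear_ext_sum_left: "bilinear_ext f (sum g I) z = (\<Sum>i\<in>I. bilinear_ext f (g i) z)"
  by (induction I rule: infinite_finite_induct) (auto simp: bilinear_ext_add_left)

lemma bilinear_ext_sum_right: "bilinear_ext f z (sum g I) = (\<Sum>i\<in>I. bilinear_ext f z (g i))"
  by (induction I rule: infinite_finite_induct) (auto simp: bilinear_ext_add_right)

lemma bilinear_ext_single_left:
  "bilinear_ext f (Poly_Mapping.single P a) z =
     (\<Sum>Q\<in>Poly_Mapping.keys z. Poly_Mapping.single (f P Q) (a * Poly_Mapping.lookup z Q))"
  by (simp add: bilinear_ext_def)

lemma bilinear_ext_single_right:
  "bilinear_ext f z (Poly_Mapping.single P a) =
     (\<Sum>Q\<in>Poly_Mapping.keys z. Poly_Mapping.single (f Q P) (Poly_Mapping.lookup z Q * a))"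
  by (simp add: bilinear_ext_def)

lemma bilinear_ext_assoc:
  assumes "\<And>P Q R. f (f P Q) R = f P (f Q R)"
  shows "bilinear_ext f (bilinear_ext f x y) z = bilinear_ext f x (bilinear_ext f y z)"
proof -
  let ?t = "\<lambda>P Q R. Poly_Mapping.single (f P (f Q R))
    (Poly_Mapping.lookup x P * Poly_Mapping.lookup y Q * Poly_Mapping.lookup z R)"
  let ?X = "Poly_Mapping.keys x" and ?Y = "Poly_Mapping.keys y" and ?Z = "Poly_Mapping.keys z"
  have "bilinear_ext f (bilinear_ext f x y) z = (\<Sum>P\<in>?X. \<Sum>Q\<in>?Y. \<Sum>R\<in>?Z. ?t P Q R)"
    by (simp add: bilinear_ext_def[of f x y] bilinear_ext_sum_left bilinear_ext_single_left assms)
  also have "\<dots> = (\<Sum>P\<in>?X. \<Sum>(Q, R)\<in>?Y \<times> ?Z. ?t P Q R)"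
    by (simp add: sum.cartesian_product)
  also have "\<dots> = (\<Sum>(Q, R)\<in>?Y \<times> ?Z. \<Sum>P\<in>?X. ?t P Q R)"
    by (subst sum.swap) (simp add: case_prod_unfold)
  also have "\<dots> = (\<Sum>Q\<in>?Y. \<Sum>R\<in>?Z. \<Sum>P\<in>?X. ?t P Q R)"
    by (rule sum.cartesian_product[symmetric])
  also have "\<dots> = bilinear_ext f x (bilinear_ext f y z)"
    by (simp add: bilinear_ext_def[of f y z] bilinear_ext_sum_right bilinear_ext_single_right
        mult.assoc)
  finally show ?thesis .
qed

lemma sum_singles:
  "(\<Sum>P\<in>Poly_Mapping.keys x. Poly_Mapping.single P (Poly_Mapping.lookup x P)) = x"
  by (rule poly_mapping_eqI) (auto simp: lookup_sum lookup_single when_def in_keys_iff)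

lemma delete_empty_append [simp]:
  "delete_empty (P @ Q) = delete_empty P @ delete_empty Q"
  by (simp add: delete_empty_def)

lemma delete_empty_map_inter_assoc:
  "delete_empty [W \<inter> Z. W \<leftarrow> delete_empty (map ((\<inter>) X) Q), Z \<leftarrow> R] =
   delete_empty (map ((\<inter>) X) (delete_empty [Y \<inter> Z. Y \<leftarrow> Q, Z \<leftarrow> R]))"
proof (induction Q)
  case (Cons Y Q)
  have 1: "delete_empty (map ((\<inter>) (X \<inter> Y)) R) =
      delete_empty (map ((\<inter>) X) (delete_empty (map ((\<inter>) Y) R)))"
    by (induction R) (auto simp: delete_empty_def Int_assoc)
  have 2: "delete_empty (map ((\<inter>) (X \<inter> Y)) R) = []" if "X \<inter> Y = {}"
    using that by (induction R) (auto simp: delete_empty_def)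
  have 3: "delete_empty (U # V) = (if U = {} then delete_empty V else U # delete_empty V)" for U V
    by (simp add: delete_empty_def)
  show ?case using Cons 1 2 by (auto simp: 3)
qed (simp add: delete_empty_def)

lemma setcomp_meet_assoc:
  "setcomp_meet (setcomp_meet P Q) R = setcomp_meet P (setcomp_meet Q R)"
proof (induction P)
  case (Cons X P)
  have "setcomp_meet (X # P) S = delete_empty (map ((\<inter>) X) S) @ setcomp_meet P S" for S
    by (simp add: setcomp_meet_def)
  moreover have "setcomp_meet (S @ T) R = setcomp_meet S R @ setcomp_meet T R" for S T
    by (simp add: setcomp_meet_def)
  moreover have "setcomp_meet (delete_empty (map ((\<inter>) X) Q)) R =
      delete_empty (map ((\<inter>) X) (setcomp_meet Q R))"
    unfolding setcomp_meet_def by (rule delete_empty_map_inter_assoc)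
  ultimately show ?case using Cons by simp
qed (simp add: setcomp_meet_def delete_empty_def)

lemma setcomps_alt:
  "P \<in> setcomps A \<longleftrightarrow> {} \<notin> set P \<and> \<Union>(set P) = A \<and> sorted_wrt (\<lambda>X Y. X \<inter> Y = {}) P"
proof -
  have "distinct P \<and> disjoint (set P) \<longleftrightarrow> sorted_wrt (\<lambda>X Y. X \<inter> Y = {}) P" if "{} \<notin> set P"
    using that by (induction P) (auto simp: pairwise_insert disjnt_def)
  then show ?thesis by (auto simp: setcomps_def partition_on_def)
qed

lemma delete_empty_in_setcomps:
  assumes "sorted_wrt (\<lambda>X Y. X \<inter> Y = {}) P"
  shows "delete_empty P \<in> setcomps (\<Union>(set P))"
  using assms by (auto simp: setcomps_alt delete_empty_def sorted_wrt_filter)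

lemma setcomp_meet_in_setcomps:
  assumes "P \<in> setcomps A" "Q \<in> setcomps A"
  shows "setcomp_meet P Q \<in> setcomps A"
proof -
  have Q: "sorted_wrt (\<lambda>X Y. X \<inter> Y = {}) Q" using assms by (simp add: setcomps_alt)
  have Q': "sorted_wrt (\<lambda>X Y. X \<inter> Y = {}) (map ((\<inter>) X) Q)" for X
    using Q by (induction Q) auto
  have "sorted_wrt (\<lambda>X Y. X \<inter> Y = {}) P" using assms by (simp add: setcomps_alt)
  then have "sorted_wrt (\<lambda>X Y. X \<inter> Y = {}) [X \<inter> Y. X \<leftarrow> P, Y \<leftarrow> Q]"
    by (induction P) (auto simp: sorted_wrt_append Q')
  from delete_empty_in_setcomps[OF this] have
    "setcomp_meet P Q \<in> setcomps (\<Union>(set [X \<inter> Y. X \<leftarrow> P, Y \<leftarrow> Q]))"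
    by (simp add: setcomp_meet_def)
  moreover have "\<Union>(set [X \<inter> Y. X \<leftarrow> P, Y \<leftarrow> Q]) = \<Union>(set P) \<inter> \<Union>(set Q)" by auto
  ultimately show ?thesis using assms by (simp add: setcomps_alt)
qed

lemma setcomp_restrict_in_setcomps:
  assumes "P \<in> setcomps A" "X \<subseteq> A"
  shows "setcomp_restrict P X \<in> setcomps X"
proof -
  have "sorted_wrt (\<lambda>X Y. X \<inter> Y = {}) P" using assms by (simp add: setcomps_alt)
  then have "sorted_wrt (\<lambda>X Y. X \<inter> Y = {}) (map (\<lambda>Y. Y \<inter> X) P)"
    by (induction P) auto
  from delete_empty_in_setcomps[OF this] have
    "setcomp_restrict P X \<in> setcomps (\<Union>(set (map (\<lambda>Y. Y \<inter> X) P)))"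
    by (simp add: setcomp_restrict_def)
  moreover have "\<Union>(set (map (\<lambda>Y. Y \<inter> X) P)) = X"
    using assms by (auto simp: setcomps_alt)
  ultimately show ?thesis by simp
qed

lemma setcomp_meet_one:
  assumes "P \<in> setcomps A"
  shows "setcomp_meet (delete_empty [A]) P = P" "setcomp_meet P (delete_empty [A]) = P"
proof -
  have P: "X \<noteq> {} \<and> X \<subseteq> A" if "X \<in> set P" for X
    using assms that by (auto simp: setcomps_alt)
  show "setcomp_meet (delete_empty [A]) P = P"
  proof (cases "A = {}")
    case True
    then have "P = []" using P by (cases P) auto
    then show ?thesis using True by (simp add: setcomp_meet_def delete_empty_def)
  next
    case False
    have "map ((\<inter>) A) P = P" using P by (intro map_idI) auto
    then show ?thesis
      using False P by (auto simp: setcomp_meet_def delete_empty_def filter_id_conv)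
  qed
  show "setcomp_meet P (delete_empty [A]) = P"
  proof (cases "A = {}")
    case True
    then have "P = []" using P by (cases P) auto
    then show ?thesis by (simp add: setcomp_meet_def delete_empty_def)
  next
    case False
    have "concat (map (\<lambda>X. [X \<inter> A]) P) = P" using P by (induction P) auto
    then show ?thesis
      using False P by (auto simp: setcomp_meet_def delete_empty_def filter_id_conv)
  qed
qed

lemma wedge_in_space:
  assumes "x \<in> setcomp_space A" "y \<in> setcomp_space A"
  shows "wedge x y \<in> setcomp_space A"
proof -
  have "Poly_Mapping.keys (wedge x y) \<subseteq> (\<Union>P\<in>Poly_Mapping.keys x. \<Union>Q\<in>Poly_Mapping.keys y.
      {setcomp_meet P Q})"
    unfolding wedge_def bilinear_ext_def
    by (intro order.trans[OF keys_sum_subset] UN_mono order.refl) auto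
  then show ?thesis
    using assms setcomp_meet_in_setcomps[of _ A] unfolding setcomp_space_def by fast
qed

lemma ring_setcomp_algebra: "ring (setcomp_algebra A :: (nat set list \<Rightarrow>\<^sub>0 'f::field) ring)"
proof -
  let ?R = "setcomp_algebra A :: (nat set list \<Rightarrow>\<^sub>0 'f) ring"
  have add: "x + y \<in> setcomp_space A" if "x \<in> setcomp_space A" "y \<in> setcomp_space A"
    for x y :: "nat set list \<Rightarrow>\<^sub>0 'f"
    using that keys_add[of x y] by (auto simp: setcomp_space_def)
  show ?thesis
  proof (rule ringI)
    show "abelian_group ?R"
    proof (rule abelian_groupI)
      fix x assume "x \<in> carrier ?R"
      then have "- x \<in> carrier ?R"
        by (simp add: setcomp_algebra_def setcomp_space_def)
      then show "\<exists>y\<in>carrier ?R. y \<oplus>\<^bsub>?R\<^esub> x = \<zero>\<^bsub>?R\<^esub>"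
        by (intro bexI[of _ "- x"]) (simp_all add: setcomp_algebra_def)
    qed (auto simp: setcomp_algebra_def add algebra_simps setcomp_space_def[of A, THEN eqset_imp_iff, of 0])
    have one: "wedge (Poly_Mapping.single (delete_empty [A]) 1) x = x"
         "wedge x (Poly_Mapping.single (delete_empty [A]) 1) = x"
      if "x \<in> setcomp_space A" for x :: "nat set list \<Rightarrow>\<^sub>0 'f"
    proof -
      have "setcomp_meet (delete_empty [A]) P = P" "setcomp_meet P (delete_empty [A]) = P"
        if "P \<in> Poly_Mapping.keys x" for P
        using that \<open>x \<in> setcomp_space A\<close> setcomp_meet_one by (auto simp: setcomp_space_def)
      then show "wedge (Poly_Mapping.single (delete_empty [A]) 1) x = x"
         "wedge x (Poly_Mapping.single (delete_empty [A]) 1) = x"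
        by (simp_all add: wedge_def bilinear_ext_single_left bilinear_ext_single_right sum_singles)
    qed
    have "delete_empty [A] \<in> setcomps A"
      using delete_empty_in_setcomps[of "[A]"] by simp
    then have "Poly_Mapping.single (delete_empty [A]) 1 \<in> setcomp_space A"
      by (simp add: setcomp_space_def)
    moreover have "wedge (wedge x y) z = wedge x (wedge y z)" for x y z :: "nat set list \<Rightarrow>\<^sub>0 'f"
      by (simp add: wedge_def bilinear_ext_assoc[of setcomp_meet, OF setcomp_meet_assoc])
    ultimately show "monoid ?R"
      by (intro monoidI) (auto simp: setcomp_algebra_def wedge_in_space one)
  qed (auto simp: setcomp_algebra_def wedge_def bilinear_ext_add_left bilinear_ext_add_right)
qed

end

theory Submission
  imports Defs
begin

text \<open>
  Everything follows from one cancellation. Split \<open>A\<close> into two non-empty parts \<open>X\<close> and \<open>Y\<close>.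
  Then the signed set compositions \<open>Q\<close> in \<open>\<Pi>\<^sub>A\<^sup>*\<close> that share the same pair of restrictions
  \<open>(Q|\<^sub>X, Q|\<^sub>Y)\<close> cancel in pairs (\<open>signed_sum_restrictions\<close>). By symmetry let \<open>Min A \<in> X\<close>. The first
  block \<open>V\<close> of \<open>Q|\<^sub>Y\<close> appears in \<open>Q\<close> either united with a block of \<open>Q|\<^sub>X\<close>, or as a block of its own.
  In the latter case it is not the first block of \<open>Q\<close>, and its predecessor is a block of
  \<open>Q|\<^sub>X\<close>. Splitting \<open>U \<union> V\<close> into \<open>U, V\<close> in the first case and merging \<open>U, V\<close> into \<open>U \<union> V\<close> in the
  second is an involution (\<open>toggle\<close>) that changes the length by one and keeps both restrictions.

  The cancellation says that the terms of \<open>\<Delta>(e\<^sub>A)\<close> for a given \<open>X\<close> other than \<open>\<emptyset>\<close> and \<open>A\<close> add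
  up to 0, so \<open>e\<^sub>A\<close> is \<open>\<Delta>\<close>-primitive. It also shows that \<open>P \<and> e\<^sub>A = 0\<close> for each \<open>P \<noteq> (A)\<close>, since
  \<open>P \<and> Q\<close> depends only on the restrictions of \<open>Q\<close> to the first block of \<open>P\<close> and to its complement.
  Therefore \<open>x \<and> e\<^sub>A\<close> is \<open>e\<^sub>A\<close> times the coefficient of \<open>(A)\<close> in \<open>x\<close>. This coefficient is 1 for
  \<open>x = e\<^sub>A\<close>, so \<open>e\<^sub>A\<close> is idempotent. The left ideal that it generates is a line, and hence
  indecomposable.
\<close>

section \<open>The splitting and merging involution\<close>

text \<open>
  With \<open>B \<subseteq> X\<close> and \<open>C \<inter> X = {}\<close>, the adjacent blocks \<open>B, C\<close> and the single block \<open>B \<union> C\<close> are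
  exchanged at the first block that is not contained in \<open>X\<close>.
\<close>

fun toggle :: "'a set \<Rightarrow> 'a set list \<Rightarrow> 'a set list" where
  "toggle X [] = []"
| "toggle X [B] = (if B \<subseteq> X then [B] else [B \<inter> X, B - X])"
| "toggle X (B # C # Q) =
     (if \<not> B \<subseteq> X then (B \<inter> X) # (B - X) # C # Q
      else if C \<inter> X = {} then (B \<union> C) # Q
      else B # toggle X (C # Q))"

lemma toggle_eq_Nil_iff [simp]: "toggle X Q = [] \<longleftrightarrow> Q = []"
  by (cases "(X, Q)" rule: toggle.cases) auto

lemma hd_toggle: "hd (toggle X Q) \<inter> X = hd Q \<inter> X"
  by (cases "(X, Q)" rule: toggle.cases) auto

lemma Union_toggle: "\<Union>(set (toggle X Q)) = \<Union>(set Q)"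
  by (induction X Q rule: toggle.induct) auto

lemma toggle_Cons:
  assumes "B \<subseteq> X" "Q \<noteq> []" "hd Q \<inter> X \<noteq> {}"
  shows "toggle X (B # Q) = B # toggle X Q"
  using assms by (cases Q) auto

lemma toggle_toggle:
  assumes "{} \<notin> set Q" "hd Q \<inter> X \<noteq> {}"
  shows "toggle X (toggle X Q) = Q"
  using assms
proof (induction X Q rule: toggle.induct)
  case (3 X B C Q)
  consider "\<not> B \<subseteq> X" | "B \<subseteq> X" "C \<inter> X = {}" | "B \<subseteq> X" "C \<inter> X \<noteq> {}" by blast
  then show ?case
  proof cases
    case 1
    then show ?thesis by auto
  next
    case 2
    then have "\<not> B \<union> C \<subseteq> X" "(B \<union> C) \<inter> X = B" "B \<union> C - X = C"
      using "3.prems" by auto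
    then show ?thesis using 2 by (cases Q) auto
  next
    case 3
    then show ?thesis
      using "3.IH" "3.prems" hd_toggle[of X "C # Q"] by (simp add: toggle_Cons)
  qed
qed auto

text \<open>
  A list of non-empty subsets of \<open>X\<close> offers nothing to split or to merge, and is a fixed point.
\<close>

lemma even_length_toggle:
  assumes "\<not> \<Union>(set Q) \<subseteq> X"
  shows "even (length (toggle X Q)) \<longleftrightarrow> odd (length Q)"
  using assms by (induction X Q rule: toggle.induct) auto

lemma empty_notin_toggle:
  assumes "{} \<notin> set Q" "hd Q \<inter> X \<noteq> {}"
  shows "{} \<notin> set (toggle X Q)"
  using assms by (induction X Q rule: toggle.induct) auto

lemma sorted_wrt_disjoint_toggle:
  assumes "sorted_wrt (\<lambda>U V. U \<inter> V = {}) Q"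
  shows "sorted_wrt (\<lambda>U V. U \<inter> V = {}) (toggle X Q)"
  using assms
proof (induction X Q rule: toggle.induct)
  case (3 X B C Q)
  consider "\<not> B \<subseteq> X" | "B \<subseteq> X" "C \<inter> X = {}" | "B \<subseteq> X" "C \<inter> X \<noteq> {}" by blast
  then show ?case
  proof cases
    case 1
    have "B \<inter> X \<inter> V = {}" "(B - X) \<inter> V = {}" if "B \<inter> V = {}" for V
      using that by blast+
    moreover have "B \<inter> X \<inter> (B - X) = {}" by blast
    ultimately show ?thesis using 1 "3.prems" by simp
  next
    case 2
    with "3.prems" show ?thesis by (simp add: Int_Un_distrib2)
  next
    case 3
    have "sorted_wrt (\<lambda>U V. U \<inter> V = {}) (toggle X (C # Q))"
      by (rule "3.IH") (use 3 "3.prems" in auto)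
    moreover have "B \<inter> \<Union>(set (C # Q)) = {}" using "3.prems" by fastforce
    then have "\<forall>D\<in>set (toggle X (C # Q)). B \<inter> D = {}"
      unfolding Union_toggle[of X "C # Q", symmetric] by blast
    moreover have "toggle X (B # C # Q) = B # toggle X (C # Q)" using 3 by simp
    ultimately show ?thesis by (simp only: sorted_wrt.simps)
  qed
qed auto

lemma toggle_in_setcomps:
  assumes "Q \<in> setcomps A" "hd Q \<inter> X \<noteq> {}"
  shows "toggle X Q \<in> setcomps A"
  using assms by (auto simp: setcomps_alt empty_notin_toggle Union_toggle sorted_wrt_disjoint_toggle)

lemma setcomp_restrict_Nil [simp]: "setcomp_restrict [] X = []"
  by (simp add: setcomp_restrict_def delete_empty_def)

lemma setcomp_restrict_Cons:
  "setcomp_restrict (B # Q) X =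
     (if B \<inter> X = {} then setcomp_restrict Q X else (B \<inter> X) # setcomp_restrict Q X)"
  by (simp add: setcomp_restrict_def delete_empty_def)

text \<open>
  Every splitting or merging separates or unites a subset of \<open>X\<close> and a set disjoint from \<open>X\<close>, and of
  these two at most one is visible in \<open>Z\<close>.
\<close>

lemma setcomp_restrict_toggle:
  assumes "Z \<subseteq> X \<or> Z \<inter> X = {}"
  shows "setcomp_restrict (toggle X Q) Z = setcomp_restrict Q Z"
proof -
  have split: "setcomp_restrict ((B \<inter> X) # (B - X) # R) Z = setcomp_restrict (B # R) Z" for B R
  proof -
    have "B \<inter> X \<inter> Z = B \<inter> Z \<and> (B - X) \<inter> Z = {} \<or> B \<inter> X \<inter> Z = {} \<and> (B - X) \<inter> Z = B \<inter> Z"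
      using assms by blast
    then show ?thesis by (elim disjE) (simp_all add: setcomp_restrict_Cons)
  qed
  have merge: "setcomp_restrict ((B \<union> C) # R) Z = setcomp_restrict (B # C # R) Z"
    if "B \<subseteq> X" "C \<inter> X = {}" for B C R
    using split[of "B \<union> C" R] that
    by (simp add: Int_Un_distrib2 Un_Diff Int_absorb2 Diff_triv Diff_eq_empty_iff[THEN iffD2])
  show ?thesis
  proof (induction Q rule: induct_list012)
    case (2 B)
    show ?case using split[of B "[]"] by simp
  next
    case (3 B C Q)
    show ?case
      using split[of B "C # Q"] merge[of B C Q] "3.IH"(2)
      by (auto simp: setcomp_restrict_Cons[of B])
  qed simp
qed

section \<open>Cancellation of signed set compositions\<close>

text \<open>
  The predicate \<open>p\<close> replaces the usual requirement that \<open>g\<close> vanishes at fixed points: over a field of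
  characteristic 2 the condition \<open>g x = - g x\<close> at a fixed point would not give \<open>g x = 0\<close>.
\<close>

lemma sum_zero_by_sign_reversing_involution:
  fixes g :: "'a \<Rightarrow> 'b::ab_group_add"
  assumes "finite S"
    and f: "\<And>x. x \<in> S \<Longrightarrow> f x \<in> S" "\<And>x. x \<in> S \<Longrightarrow> f (f x) = x"
      "\<And>x. x \<in> S \<Longrightarrow> p (f x) \<longleftrightarrow> \<not> p x" "\<And>x. x \<in> S \<Longrightarrow> g (f x) = - g x"
  shows "sum g S = 0"
proof -
  have "sum g {x \<in> S. p x} = (\<Sum>x\<in>{x \<in> S. \<not> p x}. - g x)"
    by (rule sum.reindex_bij_witness[of _ f f]) (auto simp: f)
  moreover have "sum g S = sum g {x \<in> S. p x} + sum g {x \<in> S. \<not> p x}"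
    using sum.Int_Diff[OF \<open>finite S\<close>, of g "{x. p x}"] by (simp add: Int_def set_diff_eq)
  ultimately show ?thesis by (simp add: sum_negf)
qed

lemma finite_setcomps_min: "finite A \<Longrightarrow> finite (setcomps_min A)"
  by (simp add: setcomps_min_def finite_setcomps)

lemma signed_sum_restrictions_Min:
  fixes c :: "'f::field"
  assumes "finite A" "X \<union> Y = A" "X \<inter> Y = {}" "Y \<noteq> {}" "Min A \<in> X"
  shows "(\<Sum>Q\<in>setcomps_min A. Poly_Mapping.single
           (h (setcomp_restrict Q X) (setcomp_restrict Q Y)) (c * (- 1) ^ (length Q - 1))) = 0"
proof (rule sum_zero_by_sign_reversing_involution[of _ "toggle X" "\<lambda>Q. even (length Q)"])
  show "finite (setcomps_min A)" using assms by (simp add: finite_setcomps_min)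
next
  fix Q assume "Q \<in> setcomps_min A"
  then have Q: "Q \<in> setcomps A" "Min A \<in> hd Q" by (auto simp: setcomps_min_def)
  have hd: "hd Q \<inter> X \<noteq> {}" using Q assms by auto
  have "Q \<noteq> []" using Q assms by (auto simp: setcomps_alt)
  have parity: "even (length (toggle X Q)) \<longleftrightarrow> odd (length Q)"
    using Q assms by (intro even_length_toggle) (auto simp: setcomps_alt)
  show "toggle X Q \<in> setcomps_min A"
    using Q hd hd_toggle[of X Q] assms by (auto simp: setcomps_min_def toggle_in_setcomps)
  show "toggle X (toggle X Q) = Q"
    using Q hd by (intro toggle_toggle) (auto simp: setcomps_alt)
  show "even (length (toggle X Q)) \<longleftrightarrow> \<not> even (length Q)" by (fact parity)
  have "length Q > 0" "length (toggle X Q) > 0" using \<open>Q \<noteq> []\<close> by auto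
  then have "(- 1) ^ (length (toggle X Q) - 1) = - ((- 1 :: 'f) ^ (length Q - 1))"
    using parity by (simp add: minus_one_power_iff)
  moreover have "setcomp_restrict (toggle X Q) X = setcomp_restrict Q X"
    "setcomp_restrict (toggle X Q) Y = setcomp_restrict Q Y"
    using assms by (auto intro!: setcomp_restrict_toggle)
  ultimately show "Poly_Mapping.single
      (h (setcomp_restrict (toggle X Q) X) (setcomp_restrict (toggle X Q) Y))
      (c * (- 1) ^ (length (toggle X Q) - 1)) =
    - Poly_Mapping.single (h (setcomp_restrict Q X) (setcomp_restrict Q Y))
      (c * (- 1) ^ (length Q - 1))"
    by (simp add: single_uminus)
qed

text \<open>
  Taking for \<open>h\<close> the pairing of lists gives the coproduct. The product with a set composition needs
  an \<open>h\<close> that combines the two restrictions into one list.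
\<close>

lemma signed_sum_restrictions:
  fixes c :: "'f::field"
  assumes "finite A" "X \<subseteq> A" "X \<noteq> {}" "X \<noteq> A"
  shows "(\<Sum>Q\<in>setcomps_min A. Poly_Mapping.single
           (h (setcomp_restrict Q X) (setcomp_restrict Q (A - X))) (c * (- 1) ^ (length Q - 1))) = 0"
proof (cases "Min A \<in> X")
  case True
  then show ?thesis using assms by (intro signed_sum_restrictions_Min) auto
next
  case False
  have "Min A \<in> A" using assms by (intro Min_in) auto
  with False have "Min A \<in> A - X" by simp
  then show ?thesis
    using assms by (intro signed_sum_restrictions_Min[of A "A - X" X "\<lambda>V U. h U V"]) auto
qed

section \<open>The element \<open>e\<^sub>A\<close> under the coproduct and the product\<close>

lemma lookup_e_elem:
  assumes "finite A"
  shows "Poly_Mapping.lookup (e_elem A :: nat set list \<Rightarrow>\<^sub>0 'f::field) P =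
           (if P \<in> setcomps_min A then (- 1) ^ (length P - 1) else 0)"
  using finite_setcomps_min[OF assms]
  by (simp add: e_elem_def lookup_sum lookup_single when_def)

lemma keys_e_elem:
  assumes "finite A"
  shows "Poly_Mapping.keys (e_elem A :: nat set list \<Rightarrow>\<^sub>0 'f::field) = setcomps_min A"
  by (auto simp: in_keys_iff lookup_e_elem[OF assms] split: if_splits)

lemma setcomp_restrict_trivial:
  assumes "Q \<in> setcomps A"
  shows "setcomp_restrict Q {} = []" "setcomp_restrict Q A = Q"
proof -
  have "map (\<lambda>Y. Y \<inter> A) Q = Q" using assms by (intro map_idI) (auto simp: setcomps_alt)
  then show "setcomp_restrict Q A = Q"
    using assms by (auto simp: setcomp_restrict_def delete_empty_def setcomps_alt filter_id_conv)
  show "setcomp_restrict Q {} = []" by (simp add: setcomp_restrict_def delete_empty_def)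
qed

lemma coproduct_e_elem:
  assumes "finite A" "A \<noteq> {}"
  shows "coproduct (e_elem A :: nat set list \<Rightarrow>\<^sub>0 'f::field) =
           tensor (e_elem A) empty_comp + tensor empty_comp (e_elem A)"
proof -
  define t where "t X Q = Poly_Mapping.single (setcomp_restrict Q X, setcomp_restrict Q (A - X))
      ((- 1 :: 'f) ^ (length Q - 1))" for X Q
  have "coproduct (e_elem A :: nat set list \<Rightarrow>\<^sub>0 'f) = (\<Sum>Q\<in>setcomps_min A. \<Sum>X\<in>Pow A. t X Q)"
    unfolding coproduct_def keys_e_elem[OF assms(1)]
    by (intro sum.cong refl)
      (auto simp: t_def lookup_e_elem[OF assms(1)] setcomps_min_def setcomps_alt)
  also have "\<dots> = (\<Sum>X\<in>Pow A. \<Sum>Q\<in>setcomps_min A. t X Q)" by (rule sum.swap)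
  also have "\<dots> = (\<Sum>X\<in>{A, {}}. \<Sum>Q\<in>setcomps_min A. t X Q)"
  proof (intro sum.mono_neutral_right ballI)
    fix X assume "X \<in> Pow A - {A, {}}"
    then show "(\<Sum>Q\<in>setcomps_min A. t X Q) = 0"
      unfolding t_def using signed_sum_restrictions[of A X Pair "1 :: 'f"] assms by simp
  qed (use assms in auto)
  also have "\<dots> = (\<Sum>Q\<in>setcomps_min A. t A Q) + (\<Sum>Q\<in>setcomps_min A. t {} Q)"
    using assms by simp
  also have "(\<Sum>Q\<in>setcomps_min A. t A Q) = tensor (e_elem A) empty_comp"
    unfolding tensor_def empty_comp_def bilinear_ext_single_right keys_e_elem[OF assms(1)]
    by (intro sum.cong refl)
      (auto simp: t_def lookup_e_elem[OF assms(1)] setcomps_min_def setcomp_restrict_trivial)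
  also have "(\<Sum>Q\<in>setcomps_min A. t {} Q) = tensor empty_comp (e_elem A)"
    unfolding tensor_def empty_comp_def bilinear_ext_single_left keys_e_elem[OF assms(1)]
    by (intro sum.cong refl)
      (auto simp: t_def lookup_e_elem[OF assms(1)] setcomps_min_def setcomp_restrict_trivial)
  finally show ?thesis .
qed

lemma setcomp_meet_Cons:
  "setcomp_meet (X # P) Q = setcomp_restrict Q X @ setcomp_meet P Q"
  by (simp add: setcomp_meet_def setcomp_restrict_def Int_commute[of _ X])

lemma setcomp_meet_restrict:
  assumes "\<Union>(set P) \<subseteq> Y"
  shows "setcomp_meet P (setcomp_restrict Q Y) = setcomp_meet P Q"
  using assms
proof (induction P)
  case (Cons X P)
  have "setcomp_restrict (setcomp_restrict Q Y) X = setcomp_restrict Q X"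
    using Cons.prems by (induction Q) (auto simp: setcomp_restrict_Cons Int_assoc Int_absorb1)
  then show ?case using Cons by (simp add: setcomp_meet_Cons)
qed (simp add: setcomp_meet_def delete_empty_def)

lemma wedge_single_e_elem:
  fixes a :: "'f::field"
  assumes "finite A" "P \<in> setcomps A" "P \<noteq> [A]" "A \<noteq> {}"
  shows "wedge (Poly_Mapping.single P a) (e_elem A) = 0"
proof -
  obtain X P' where P: "P = X # P'" using assms by (cases P) (auto simp: setcomps_alt)
  have X: "X \<noteq> {}" "X \<subseteq> A" and P': "\<Union>(set P') = A - X" "{} \<notin> set P'"
    using assms(2) by (auto simp: P setcomps_alt)
  have "X \<noteq> A" using P' assms(3) by (cases P') (auto simp: P)
  have "setcomp_meet P Q =
      setcomp_restrict Q X @ setcomp_meet P' (setcomp_restrict Q (A - X))" for Q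
    using P' by (simp add: P setcomp_meet_Cons setcomp_meet_restrict)
  then have "wedge (Poly_Mapping.single P a) (e_elem A) =
      (\<Sum>Q\<in>setcomps_min A. Poly_Mapping.single
        (setcomp_restrict Q X @ setcomp_meet P' (setcomp_restrict Q (A - X)))
        (a * (- 1) ^ (length Q - 1)))"
    unfolding wedge_def bilinear_ext_single_left keys_e_elem[OF assms(1)]
    by (intro sum.cong refl) (simp add: lookup_e_elem[OF assms(1)])
  also have "\<dots> = 0"
    using signed_sum_restrictions[OF assms(1) X(2,1) \<open>X \<noteq> A\<close>,
        where h = "\<lambda>U V. U @ setcomp_meet P' V"] .
  finally show ?thesis .
qed

text \<open>
  The right-hand side is the scalar multiple of \<open>e\<^sub>A\<close> by the coefficient of \<open>(A)\<close> in \<open>x\<close>, because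
  \<open>(A)\<close> is the identity.
\<close>

lemma wedge_e_elem:
  fixes x :: "nat set list \<Rightarrow>\<^sub>0 'f::field"
  assumes "finite A" "A \<noteq> {}" "x \<in> setcomp_space A"
  shows "wedge x (e_elem A) = wedge (Poly_Mapping.single [A] (Poly_Mapping.lookup x [A])) (e_elem A)"
proof -
  let ?t = "\<lambda>P. wedge (Poly_Mapping.single P (Poly_Mapping.lookup x P)) (e_elem A)"
  have "wedge x (e_elem A) =
      wedge (\<Sum>P\<in>Poly_Mapping.keys x. Poly_Mapping.single P (Poly_Mapping.lookup x P)) (e_elem A)"
    by (simp add: sum_singles)
  also have "\<dots> = (\<Sum>P\<in>Poly_Mapping.keys x. ?t P)"
    by (simp add: wedge_def bilinear_ext_sum_left)
  also have "\<dots> = (\<Sum>P\<in>insert [A] (Poly_Mapping.keys x). ?t P)"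
    by (intro sum.mono_neutral_left) (auto simp: in_keys_iff wedge_def)
  also have "\<dots> = (\<Sum>P\<in>{[A]}. ?t P)"
    using assms wedge_single_e_elem[OF assms(1) _ _ assms(2)]
    by (intro sum.mono_neutral_right) (auto simp: setcomp_space_def)
  finally show ?thesis by simp
qed

section \<open>Primitive idempotents generating a minimal left ideal\<close>

lemma (in ring) left_ideal_generated_by:
  assumes "e \<in> carrier R"
  shows "left_ideal {r \<otimes> e | r. r \<in> carrier R} R"
  unfolding left_ideal_def
proof (intro conjI ballI)
  show "additive_subgroup {r \<otimes> e | r. r \<in> carrier R} R"
  proof (intro additive_subgroup.intro subgroup.intro)
    fix x y
    assume "x \<in> {r \<otimes> e | r. r \<in> carrier R}" "y \<in> {r \<otimes> e | r. r \<in> carrier R}"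
    then show "x \<otimes>\<^bsub>add_monoid R\<^esub> y \<in> {r \<otimes> e | r. r \<in> carrier R}"
      using assms by (auto simp: l_distr[symmetric])
  next
    have "\<zero> = \<zero> \<otimes> e" using assms by simp
    then show "\<one>\<^bsub>add_monoid R\<^esub> \<in> {r \<otimes> e | r. r \<in> carrier R}"
      using zero_closed by auto
  next
    fix x assume "x \<in> {r \<otimes> e | r. r \<in> carrier R}"
    then obtain r where r: "r \<in> carrier R" "x = r \<otimes> e" by auto
    then have "\<ominus> x = (\<ominus> r) \<otimes> e" using assms by (simp add: l_minus)
    then show "inv\<^bsub>add_monoid R\<^esub> x \<in> {r \<otimes> e | r. r \<in> carrier R}"
      using r by (auto simp: a_inv_def[symmetric])
  qed (use assms in auto)
next
  fix s x assume "s \<in> carrier R" "x \<in> {r \<otimes> e | r. r \<in> carrier R}"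
  then show "s \<otimes> x \<in> {r \<otimes> e | r. r \<in> carrier R}"
    using assms by (auto simp: m_assoc[symmetric])
qed

text \<open>
  The last hypothesis makes \<open>Re\<close> minimal: any non-zero left ideal inside \<open>Re\<close> contains \<open>e\<close>, so two
  non-zero summands of \<open>Re\<close> would meet in the non-zero element \<open>e\<close>.
\<close>

lemma (in ring) primitive_idempotent_if_minimal:
  assumes e: "idempotent_elem e R"
    and minimal: "\<And>r. r \<in> carrier R \<Longrightarrow> r \<otimes> e \<noteq> \<zero> \<Longrightarrow> \<exists>s\<in>carrier R. s \<otimes> (r \<otimes> e) = e"
  shows "primitive_idempotent e R"
proof -
  let ?M = "{r \<otimes> e | r. r \<in> carrier R}"
  have e': "e \<in> carrier R" "e \<noteq> \<zero>" "e \<otimes> e = e" using e by (auto simp: idempotent_elem_def)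
  have "e \<in> ?M" using e' by force
  have zero_in: "\<zero> \<in> N" and in_carrier: "N \<subseteq> carrier R" if "left_ideal N R" for N
    using that unfolding left_ideal_def
    by (blast intro: additive_subgroup.zero_closed dest: additive_subgroup.a_subset)+
  have e_in: "e \<in> N" if N: "left_ideal N R" "N \<subseteq> ?M" "N \<noteq> {\<zero>}" for N
  proof -
    obtain x where x: "x \<in> N" "x \<noteq> \<zero>" using N zero_in by blast
    then obtain r where "r \<in> carrier R" "x = r \<otimes> e" using N by auto
    with x minimal obtain s where "s \<in> carrier R" "s \<otimes> x = e" by blast
    then show ?thesis using N x by (auto simp: left_ideal_def)
  qed
  have "N = {\<zero>} \<or> N' = {\<zero>}"
    if N: "left_ideal N R" "left_ideal N' R" "?M = N <+>\<^bsub>R\<^esub> N'" "N \<inter> N' = {\<zero>}" for N N'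
  proof (rule ccontr)
    assume nonzero: "\<not> (N = {\<zero>} \<or> N' = {\<zero>})"
    have "x \<in> N <+>\<^bsub>R\<^esub> N'" if "x \<in> N" for x
    proof -
      have "x = x \<oplus> \<zero>" using that in_carrier[OF N(1)] by auto
      then show ?thesis using that zero_in[OF N(2)] by (auto simp: set_add_def')
    qed
    moreover have "x \<in> N <+>\<^bsub>R\<^esub> N'" if "x \<in> N'" for x
    proof -
      have "x = \<zero> \<oplus> x" using that in_carrier[OF N(2)] by auto
      then show ?thesis using that zero_in[OF N(1)] by (auto simp: set_add_def')
    qed
    ultimately have "N \<subseteq> ?M" "N' \<subseteq> ?M" using N(3) by blast+
    then have "e \<in> N \<inter> N'" using e_in N nonzero by blast
    then show False using N(4) e' by blast
  qed
  moreover have "?M \<noteq> {\<zero>}" using \<open>e \<in> ?M\<close> e' by blast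
  ultimately show ?thesis
    using e left_ideal_generated_by[OF e'(1)]
    by (simp add: primitive_idempotent_def indecomposable_left_ideal_def)
qed

section \<open>The primitive idempotent \<open>e\<^sub>A\<close>\<close>

lemma primitive_idempotent_e_elem:
  assumes "finite A" "A \<noteq> {}"
  shows "primitive_idempotent (e_elem A :: nat set list \<Rightarrow>\<^sub>0 'f::field) (setcomp_algebra A)"
proof -
  let ?R = "setcomp_algebra A :: (nat set list \<Rightarrow>\<^sub>0 'f) ring"
  let ?e = "e_elem A :: nat set list \<Rightarrow>\<^sub>0 'f"
  let ?s = "\<lambda>c :: 'f. Poly_Mapping.single [A] c"
  interpret ring ?R by (rule ring_setcomp_algebra)
  have "[A] \<in> setcomps_min A" using assms by (auto simp: setcomps_min_def setcomps_alt)
  then have lookup_A: "Poly_Mapping.lookup ?e [A] = 1" by (simp add: lookup_e_elem assms)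
  have s_in: "?s c \<in> carrier ?R" for c
    using \<open>[A] \<in> setcomps_min A\<close>
    by (auto simp: setcomp_algebra_def setcomp_space_def setcomps_min_def)
  have e_in: "?e \<in> carrier ?R" using e_elem_in_space by (simp add: setcomp_algebra_def)
  have one_e: "wedge (?s 1) ?e = ?e"
    using l_one[OF e_in] assms by (simp add: setcomp_algebra_def delete_empty_def)
  have s_mult: "wedge (?s c) (?s d) = ?s (c * d)" for c d
    using assms by (auto simp: wedge_def bilinear_ext_def setcomp_meet_def delete_empty_def)
  show ?thesis
  proof (rule primitive_idempotent_if_minimal)
    show "idempotent_elem ?e ?R"
      using e_in lookup_A one_e wedge_e_elem[OF assms e_elem_in_space, where 'f = 'f]
      by (auto simp: idempotent_elem_def setcomp_algebra_def)
  next
    fix r assume r: "r \<in> carrier ?R" "r \<otimes>\<^bsub>?R\<^esub> ?e \<noteq> \<zero>\<^bsub>?R\<^esub>"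
    define c where "c = Poly_Mapping.lookup r [A]"
    have re: "r \<otimes>\<^bsub>?R\<^esub> ?e = ?s c \<otimes>\<^bsub>?R\<^esub> ?e"
      using wedge_e_elem[OF assms, of r] r by (simp add: setcomp_algebra_def c_def)
    with r have "c \<noteq> 0" by (auto simp: setcomp_algebra_def wedge_def)
    have "?s (inverse c) \<otimes>\<^bsub>?R\<^esub> (r \<otimes>\<^bsub>?R\<^esub> ?e) = (?s (inverse c) \<otimes>\<^bsub>?R\<^esub> ?s c) \<otimes>\<^bsub>?R\<^esub> ?e"
      by (simp add: re m_assoc s_in e_in)
    also have "\<dots> = ?e" using \<open>c \<noteq> 0\<close> by (simp add: setcomp_algebra_def s_mult one_e)
    finally show "\<exists>s\<in>carrier ?R. s \<otimes>\<^bsub>?R\<^esub> (r \<otimes>\<^bsub>?R\<^esub> ?e) = ?e" using s_in by blast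
  qed
qed

theorem lemma4p5:
  fixes A :: "nat set"
  assumes "finite A" and "A \<subseteq> {1..}" and "A \<noteq> {}"
  shows "coproduct (e_elem A :: nat set list \<Rightarrow>\<^sub>0 'f::field) =
           tensor (e_elem A) empty_comp + tensor empty_comp (e_elem A)
       \<and> primitive_idempotent (e_elem A :: nat set list \<Rightarrow>\<^sub>0 'f) (setcomp_algebra A)"
  using coproduct_e_elem primitive_idempotent_e_elem assms by blast

end
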